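(* Let $x_0=0$ and let $\{x_n\}_{n\in\mathbb{N}}$ be a strictly increasing sequence of positive numbers with $\lim_{n\to+\infty}x_n=+\infty$ and $\inf_{n\in\mathbb{N}}(x_n-x_{n-1})>1$. Let $C$ be the comb domain \[C=\{z\in\mathbb{C}:\mathrm{Re}\, z>-x_1\}\setminus\bigcup_{n\in\mathbb{N}\cup\{0\}}\{x_n+iy: y\in\mathbb{R},\ |y|\ge 1\},\] and set $\alpha_n=x_n-x_{n-1}$ for $n\in\mathbb{N}$. Suppose $\alpha_n\le e^n$ for every $n\in\mathbb{N}$. If \[\lim_{n\to+\infty}\alpha_n=+\infty,\] then ${\rm h}(C)=+\infty$.
   Context: $\mathbb{N}=\{1,2,3,\dots\}$ and $\mathbb{D}$ is the open unit disk in $\mathbb{C}$. For $p>0$, the Hardy space $H^p(\mathbb{D})$ is the set of all holomorphic functions $f$ on $\mathbb{D}$ with $\sup_{0<r<1}\int_0^{2\pi}|f(re^{i\theta})|^p\,d\theta<+\infty$. If $D\ne\mathbb{C}$ is a simply connected domain and $f$ is a Riemann mapping (conformal bijection) from $\mathbb{D}$ onto $D$, the Hardy number of $D$ is ${\rm h}(D)=\sup\{p>0: f\in H^p(\mathbb{D})\}\in[1/2,+\infty]$; it does not depend on the choice of $f$. *)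

theory Defs
  imports "HOL-Complex_Analysis.Complex_Analysis"
begin

(* Only used for p > 0, where "0 powr p = 0" is the intended value.  The integrand is
   continuous for holomorphic f and 0 < r < 1, so every integral below exists. *)
definition hardy_space :: "real \<Rightarrow> (complex \<Rightarrow> complex) set" where
  "hardy_space p = {f. f holomorphic_on ball 0 1 \<and>
     bdd_above ((\<lambda>r. integral {0..2 * pi} (\<lambda>\<theta>. norm (f (of_real r * cis \<theta>)) powr p)) ` {0<..<1})}"

definition riemann_mapping :: "(complex \<Rightarrow> complex) \<Rightarrow> complex set \<Rightarrow> bool" where
  "riemann_mapping f D \<longleftrightarrow> f holomorphic_on ball 0 1 \<and> bij_betw f (ball 0 1) D"

(* Meaningful for simply connected domains D other than {} and UNIV, where a Riemann mapping
   exists; the value does not depend on which one is chosen. *)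
definition hardy_number :: "complex set \<Rightarrow> ereal" where
  "hardy_number D =
     (let f = (SOME f. riemann_mapping f D) in Sup (ereal ` {p. p > 0 \<and> f \<in> hardy_space p}))"

definition comb_domain :: "(nat \<Rightarrow> real) \<Rightarrow> complex set" where
  "comb_domain x = {z. Re z > - x 1} - (\<Union>n. {Complex (x n) y | y. \<bar>y\<bar> \<ge> 1})"

end

theory Submission
  imports Defs
begin

text \<open>
  Let \<open>f\<close> map the unit disc conformally onto the comb. A map of the disc that omits a half-line with
  tip \<open>b\<close> satisfies \<open>(1 - |z|) |f'(z)| \<le> 4 |f z - b|\<close>, so \<open>(1 - |z|) |f'(z)| \<le> 4 (1 + |Re (f z) - x n|)\<close>
  for every \<open>n\<close>. Crossing the \<open>k\<close>-th strip therefore costs hyperbolic length comparable to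
  \<open>ln (1 + \<alpha> k)\<close>, which exceeds any constant \<open>K\<close> for large \<open>k\<close>, whereas \<open>ln (x n) \<le> n + 1\<close>;
  hence \<open>Re f\<close>, and then by the derivative estimate \<open>f\<close>, is \<open>O((1 - |z|) powr (- e))\<close> for every
  \<open>e > 0\<close>. For univalent functions such growth gives membership in every Hardy space: the area of
  the image bounds the Dirichlet integral on dyadic annuli, and integrating
  \<open>d/ds |f|^m \<le> m |f|^(m-1) |f'|\<close> over them gives a convergent geometric series.
\<close>

unbundle no fps_syntax

section \<open>Koebe-type derivative estimates\<close>

text \<open>Schwarz lemma for \<open>h\<close> rescaled to the unit disc and followed by a map of
  the right half-plane onto the disc. The derivative of the resulting self-map at 0 has modulus
  \<open>norm (deriv h z) * R / (2 * Re (h z))\<close>.\<close>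

lemma norm_deriv_le_Re:
  assumes h: "h holomorphic_on ball z R" and R: "R > 0"
    and pos: "\<And>w. w \<in> ball z R \<Longrightarrow> Re (h w) > 0"
  shows "norm (deriv h z) * R \<le> 2 * Re (h z)"
proof -
  define c where "c = h z"
  \<comment> \<open>Cayley transform of the half-plane sending \<open>h z\<close> to 0\<close>
  define k where "k = (\<lambda>\<zeta>. (h (z + of_real R * \<zeta>) - c) / (h (z + of_real R * \<zeta>) + cnj c))"
  have c: "Re c > 0" using pos[of z] R by (simp add: c_def)
  have in_ball: "z + of_real R * \<zeta> \<in> ball z R" if "\<zeta> \<in> ball 0 1" for \<zeta>
    using that R by (simp add: dist_norm norm_mult)
  have h': "(\<lambda>\<zeta>. h (z + of_real R * \<zeta>)) holomorphic_on ball 0 1"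
    by (rule holomorphic_on_compose_gen[OF _ h, unfolded o_def])
       (use in_ball in \<open>auto intro!: holomorphic_intros\<close>)
  have nz: "h (z + of_real R * \<zeta>) + cnj c \<noteq> 0" if "\<zeta> \<in> ball 0 1" for \<zeta>
    using pos[OF in_ball[OF that]] c by (auto simp: complex_eq_iff)
  have k: "k holomorphic_on ball 0 1"
    unfolding k_def using h' nz by (intro holomorphic_intros) auto
  have k_less: "norm (k \<zeta>) < 1" if "norm \<zeta> < 1" for \<zeta>
  proof -
    have \<zeta>: "\<zeta> \<in> ball 0 1" using that by simp
    define a where "a = h (z + of_real R * \<zeta>)"
    have a: "Re a > 0" using pos[OF in_ball[OF \<zeta>]] by (simp add: a_def)
    \<comment> \<open>The difference of the two squares is \<open>4 * Re a * Re c\<close>.\<close>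
    have "(norm (a - c))\<^sup>2 < (norm (a + cnj c))\<^sup>2"
      using mult_pos_pos[OF a c] unfolding cmod_power2 by (simp add: power2_eq_square algebra_simps)
    then have "norm (a - c) < norm (a + cnj c)"
      by (rule power2_less_imp_less) simp
    moreover have "norm (a + cnj c) > 0" using nz[OF \<zeta>] by (simp add: a_def)
    ultimately show ?thesis by (simp add: k_def a_def norm_divide)
  qed
  have "norm (deriv k 0) \<le> 1"
    using Schwarz_Lemma(2)[OF k _ k_less, of 0] by (simp add: k_def c_def)
  \<comment> \<open>In the quotient rule the second term drops out because the numerator of
    \<open>k\<close> vanishes at 0.\<close>
  moreover have "(k has_field_derivative deriv h z * of_real R / (c + cnj c)) (at 0)"
  proof -
    have hd: "(h has_field_derivative deriv h z) (at (z + of_real R * 0))"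
      using holomorphic_derivI[OF h _ ] R by simp
    have "((\<lambda>\<zeta>. z + of_real R * \<zeta>) has_field_derivative of_real R) (at 0)"
      by (auto intro!: derivative_eq_intros)
    from DERIV_chain2[OF hd this]
    have hd2: "((\<lambda>\<zeta>. h (z + of_real R * \<zeta>)) has_field_derivative deriv h z * of_real R) (at 0)" .
    have "(k has_field_derivative (deriv h z * of_real R * (h (z + of_real R * 0) + cnj c)
        - (h (z + of_real R * 0) - c) * (deriv h z * of_real R))
        / ((h (z + of_real R * 0) + cnj c) * (h (z + of_real R * 0) + cnj c))) (at 0)"
      unfolding k_def
      by (intro DERIV_divide) (use nz[of 0] hd2 in \<open>auto intro!: derivative_eq_intros\<close>)
    then show ?thesis using nz[of 0] by (simp add: c_def)
  qed
  then have "deriv k 0 = deriv h z * of_real R / (c + cnj c)" by (rule DERIV_imp_deriv)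
  moreover have "c + cnj c = of_real (2 * Re c)" by (simp add: complex_add_cnj)
  ultimately show ?thesis using c R
    by (simp add: norm_divide norm_mult c_def field_simps)
qed

text \<open>A square root \<open>h\<close> opens the complement of the half-line to a half-plane,
  where the previous estimate applies. Since \<open>h ^ 2\<close> is \<open>f - b\<close> up to a
  unimodular factor, \<open>|f'| = 2 |h| |h'|\<close>, and bounding \<open>Re h\<close> by
  \<open>|h|\<close> produces the factor 4.\<close>

lemma norm_deriv_le_slit:
  assumes f: "f holomorphic_on ball z R" and R: "R > 0" and d: "norm d = 1"
    and slit: "\<And>w t. w \<in> ball z R \<Longrightarrow> t \<ge> 0 \<Longrightarrow> f w \<noteq> b + of_real t * d"
  shows "norm (deriv f z) * R \<le> 4 * norm (f z - b)"
proof -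
  \<comment> \<open>Division by \<open>- d\<close> turns the omitted half-line into the nonpositive
    real axis, the branch cut of \<open>csqrt\<close>.\<close>
  define g where "g = (\<lambda>w. (f w - b) / (- d))"
  define h where "h = (\<lambda>w. csqrt (g w))"
  have d0: "d \<noteq> 0" using d by auto
  have g_slit: "g w \<notin> \<real>\<^sub>\<le>\<^sub>0" if w: "w \<in> ball z R" for w
  proof
    assume "g w \<in> \<real>\<^sub>\<le>\<^sub>0"
    then obtain t where t: "g w = of_real t" "t \<le> 0" by (auto elim: nonpos_Reals_cases)
    then have "f w = b + of_real (- t) * d" using d0 by (simp add: g_def field_simps)
    with slit[OF w, of "- t"] t show False by simp
  qed
  have g: "g holomorphic_on ball z R"
    unfolding g_def using f d0 by (intro holomorphic_intros) auto
  have h: "h holomorphic_on ball z R"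
    unfolding h_def using g g_slit by (intro holomorphic_intros) auto
  have "norm (deriv h z) * R \<le> 2 * Re (h z)"
  proof (rule norm_deriv_le_Re[OF h R])
    show "Re (h w) > 0" if w: "w \<in> ball z R" for w
    proof (rule ccontr)
      assume "\<not> Re (h w) > 0"
      \<comment> \<open>Values of \<open>csqrt\<close> have nonnegative real part, so only purely
        imaginary values have to be excluded; their squares would lie on the cut.\<close>
      then have "Re (h w) = 0" using Re_csqrt[of "g w"] by (simp add: h_def)
      then have "h w = \<i> * of_real (Im (h w))" by (simp add: complex_eq_iff)
      then have "(h w)\<^sup>2 = - of_real ((Im (h w))\<^sup>2)"
        by (metis power_mult_distrib power2_i mult_minus1 of_real_power)
      then have "g w = of_real (- ((Im (h w))\<^sup>2))" by (simp add: h_def)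
      then have "g w \<in> \<real>\<^sub>\<le>\<^sub>0" by (auto simp: complex_nonpos_Reals_iff)
      with g_slit[OF w] show False by simp
    qed
  qed
  also have "\<dots> \<le> 2 * norm (h z)" using complex_Re_le_cmod by simp
  finally have *: "norm (deriv h z) * R \<le> 2 * norm (h z)" .
  have z: "z \<in> ball z R" using R by simp
  have "(g has_field_derivative deriv f z / (- d)) (at z)"
    unfolding g_def using d0
    by (auto intro!: derivative_eq_intros holomorphic_derivI[OF f _ z])
  moreover have "((\<lambda>w. h w ^ 2) has_field_derivative 2 * h z * deriv h z) (at z)"
    by (auto intro!: derivative_eq_intros holomorphic_derivI[OF h _ z])
  then have "(g has_field_derivative 2 * h z * deriv h z) (at z)" by (simp add: h_def)
  ultimately have "deriv f z / (- d) = 2 * h z * deriv h z" by (rule DERIV_unique)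
  then have "norm (deriv f z / (- d)) = norm (2 * h z * deriv h z)" by simp
  then have "norm (deriv f z) * R = 2 * norm (h z) * (norm (deriv h z) * R)"
    using d by (simp add: norm_divide norm_mult)
  also have "\<dots> \<le> 2 * norm (h z) * (2 * norm (h z))"
    using * by (intro mult_left_mono) auto
  also have "\<dots> = 4 * norm (h z ^ 2)" by (simp add: norm_mult power2_eq_square)
  also have "norm (h z ^ 2) = norm (f z - b)" using d by (simp add: h_def g_def norm_divide)
  finally show ?thesis by simp
qed

text \<open>The bound is free of \<open>Im (f z)\<close> because the half-line may start anywhere on
  a tooth: at the height of \<open>f z\<close> if that height is beyond the tip, otherwise at a
  nearest tip. The starting point \<open>b\<close> is then at vertical distance at most 1 from
  \<open>f z\<close>.\<close>

lemma norm_deriv_le_comb: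
  assumes f: "f holomorphic_on ball 0 1" and comb: "f ` ball 0 1 \<subseteq> comb_domain x" and z: "norm z < 1"
  shows "norm (deriv f z) * (1 - norm z) \<le> 4 * (1 + \<bar>Re (f z) - x n\<bar>)"
proof -
  define s :: real where "s = (if Im (f z) \<ge> 0 then 1 else - 1)"
  define y where "y = max 1 \<bar>Im (f z)\<bar>"
  define b where "b = Complex (x n) (s * y)"
  have sub: "ball z (1 - norm z) \<subseteq> ball 0 1" by (simp add: ball_subset_ball_iff)
  have "norm (deriv f z) * (1 - norm z) \<le> 4 * norm (f z - b)"
  proof (rule norm_deriv_le_slit)
    show "f holomorphic_on ball z (1 - norm z)" using f sub by (rule holomorphic_on_subset)
    show "1 - norm z > 0" using z by simp
    show "norm (\<i> * of_real s) = 1" by (simp add: norm_mult s_def)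
    show "f w \<noteq> b + of_real t * (\<i> * of_real s)" if "w \<in> ball z (1 - norm z)" "t \<ge> 0" for w t
    proof
      assume eq: "f w = b + of_real t * (\<i> * of_real s)"
      have "f w = Complex (x n) (s * (y + t))"
        by (simp add: eq b_def complex_eq_iff algebra_simps)
      moreover have "\<bar>s * (y + t)\<bar> \<ge> 1" using that by (auto simp: s_def y_def)
      ultimately have "f w \<notin> comb_domain x" unfolding comb_domain_def by blast
      then show False using that sub comb by blast
    qed
  qed
  also have "norm (f z - b) \<le> \<bar>Re (f z - b)\<bar> + \<bar>Im (f z - b)\<bar>" by (rule cmod_le)
  also have "\<dots> \<le> \<bar>Re (f z) - x n\<bar> + 1" by (auto simp: b_def s_def y_def)
  finally show ?thesis by simp
qed

section \<open>Area of univalent images\<close>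

lemma mem_cbox_2: "v \<in> cbox a b \<longleftrightarrow> a $ 1 \<le> v $ 1 \<and> v $ 1 \<le> b $ 1 \<and> a $ 2 \<le> v $ 2 \<and> v $ 2 \<le> b $ 2"
  for v :: "real^2"
  by (auto simp: mem_box_cart forall_2)

lemma mem_box_2: "v \<in> box a b \<longleftrightarrow> a $ 1 < v $ 1 \<and> v $ 1 < b $ 1 \<and> a $ 2 < v $ 2 \<and> v $ 2 < b $ 2"
  for v :: "real^2"
  by (auto simp: mem_box_cart forall_2)

lemma content_cbox_2:
  fixes a b :: "real^2"
  shows "measure lborel (cbox a b) = measure lborel (cbox (a $ 1, a $ 2) (b $ 1, b $ 2))"
proof (cases "cbox a b = {}")
  case True
  then have "\<not> (a $ 1 \<le> b $ 1 \<and> a $ 2 \<le> b $ 2)"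
    by (metis mem_cbox_2 empty_iff order_refl)
  then show ?thesis using True by (auto simp: content_Pair)
next
  case False
  then obtain v where "v \<in> cbox a b" by blast
  then have "a $ 1 \<le> b $ 1 \<and> a $ 2 \<le> b $ 2" by (auto simp: mem_cbox_2)
  then show ?thesis using False
    by (simp add: content_cbox_cart content_Pair UNIV_2)
qed

text \<open>Links the two models of the plane in use: the change of variables formula is applied on
  \<open>real^2\<close>, iterated integration on pairs of reals. The coordinate bijection maps boxes
  to boxes and preserves their content.\<close>

lemma has_integral_vec2:
  fixes f :: "real \<times> real \<Rightarrow> real"
  assumes "(f has_integral i) (cbox (a,c) (b,d))"
  shows "((\<lambda>v. f (v $ 1, v $ 2)) has_integral i) (cbox (vector [a,c] :: real^2) (vector [b,d]))"
proof -
  define g where "g = (\<lambda>v::real^2. (v $ 1, v $ 2))"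
  define h where "h = (\<lambda>p. vector [fst p, snd p] :: real^2)"
  have hg: "h (g v) = v" for v by (simp add: g_def h_def vec_eq_iff forall_2)
  have gh: "g (h p) = p" for p by (simp add: g_def h_def)
  have g_im: "g ` cbox u v = cbox (u $ 1, u $ 2) (v $ 1, v $ 2)" for u v
  proof -
    have "p \<in> g ` cbox u v" if "p \<in> cbox (u $ 1, u $ 2) (v $ 1, v $ 2)" for p
      using that gh[of p] by (intro image_eqI[of _ _ "h p"]) (auto simp: mem_cbox_2 cbox_Pair_eq h_def)
    then show ?thesis by (auto simp: g_def mem_cbox_2 cbox_Pair_eq)
  qed
  have h_im: "h ` cbox u v = cbox (h u) (h v)" for u v
  proof -
    have "h ` cbox u v = h ` g ` cbox (h u) (h v)" using g_im[of "h u" "h v"] by (simp add: h_def)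
    then show ?thesis by (simp add: image_image hg)
  qed
  have "((\<lambda>v. f (g v)) has_integral (1 / 1) *\<^sub>R i) (h ` cbox (a,c) (b,d))"
  proof (rule has_integral_twiddle[OF _ hg gh _ _ _ _ assms])
    show "continuous (at v) g" for v unfolding g_def by (intro continuous_intros)
    show "\<exists>w z. g ` cbox u v = cbox w z" for u v using g_im by blast
    show "\<exists>w z. h ` cbox u v = cbox w z" for u v using h_im by blast
    show "measure lborel (g ` cbox u v) = 1 * measure lborel (cbox u v)" for u v
      by (simp add: g_im content_cbox_2)
  qed simp
  then show ?thesis by (simp add: h_im) (simp add: g_def h_def)
qed

text \<open>The real Jacobian of a holomorphic map is the squared modulus of its derivative, so for
  an injective map the integral is the area of the image, here contained in a square of side
  \<open>2 * M\<close>.\<close>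

lemma integral_norm_deriv_square_le:
  assumes U: "open U" and F: "F holomorphic_on U"
    and rect: "\<And>s t. s \<in> {a..b} \<Longrightarrow> t \<in> {c..d} \<Longrightarrow> Complex s t \<in> U"
    and inj: "inj_on F {w. a < Re w \<and> Re w < b \<and> c < Im w \<and> Im w < d}"
    and bd: "\<And>s t. s \<in> {a..b} \<Longrightarrow> t \<in> {c..d} \<Longrightarrow> norm (F (Complex s t)) \<le> M"
    and "M \<ge> 0"
  shows "integral (cbox (a,c) (b,d)) (\<lambda>(s,t). (norm (deriv F (Complex s t)))\<^sup>2) \<le> 4 * M\<^sup>2"
proof -
  define J where "J = (\<lambda>v::real^2. Complex (v $ 1) (v $ 2))"
  define J' where "J' = (\<lambda>z. vector [Re z, Im z] :: real^2)"
  have JJ': "J (J' z) = z" for z by (simp add: J_def J'_def)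
  have J'J: "J' (J v) = v" for v by (simp add: J_def J'_def vec_eq_iff forall_2)
  have lJ: "bounded_linear J"
    by (rule linear_conv_bounded_linear[THEN iffD1], rule linearI)
       (simp_all add: J_def complex_eq_iff)
  have lJ': "bounded_linear J'"
    by (rule linear_conv_bounded_linear[THEN iffD1], rule linearI)
       (simp_all add: J'_def vec_eq_iff forall_2)
  define l u :: "real^2" where "l = vector [a,c]" and "u = vector [b,d]"
  define g where "g = (\<lambda>v. J' (F (J v)))"
  define g' where "g' = (\<lambda>v w. J' (deriv F (J v) * J w))"
  have JU: "J v \<in> U" if "v \<in> cbox l u" for v
    using rect that by (auto simp: J_def mem_cbox_2 l_def u_def)
  have der: "(g has_derivative g' v) (at v within S)" if "v \<in> cbox l u" for v S
  proof -
    have "(F has_field_derivative deriv F (J v)) (at (J v))"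
      using holomorphic_derivI[OF F U JU[OF that]] .
    then have "(F has_derivative (\<lambda>h. deriv F (J v) * h)) (at (J v))"
      by (simp add: has_field_derivative_def)
    from bounded_linear.has_derivative[OF lJ' has_derivative_compose[OF bounded_linear_imp_has_derivative[OF lJ] this]]
    show ?thesis unfolding g_def g'_def by (rule has_derivative_at_withinI)
  qed
  have det: "\<bar>det (matrix (g' v))\<bar> = (norm (deriv F (J v)))\<^sup>2" for v
    unfolding det_2 matrix_def g'_def J'_def J_def
    by (simp add: axis_def cmod_power2) (simp add: power2_eq_square)
  have contD: "continuous_on (cbox (a,c) (b,d)) (\<lambda>p. (norm (deriv F (Complex (fst p) (snd p))))\<^sup>2)"
  proof (intro continuous_intros)
    have "continuous_on U (deriv F)"
      using holomorphic_deriv[OF F U] by (rule holomorphic_on_imp_continuous_on)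
    moreover have "continuous_on (cbox (a,c) (b,d)) (\<lambda>p. Complex (fst p) (snd p))"
      unfolding Complex_eq by (intro continuous_intros)
    ultimately show "continuous_on (cbox (a,c) (b,d)) (\<lambda>p. deriv F (Complex (fst p) (snd p)))"
      by (rule continuous_on_compose2) (use rect in \<open>auto simp: cbox_Pair_eq\<close>)
  qed
  let ?I = "integral (cbox (a,c) (b,d)) (\<lambda>p. (norm (deriv F (Complex (fst p) (snd p))))\<^sup>2)"
  have "((\<lambda>p. (norm (deriv F (Complex (fst p) (snd p))))\<^sup>2) has_integral ?I) (cbox (a,c) (b,d))"
    using integrable_continuous[OF contD] by (rule integrable_integral)
  from has_integral_vec2[OF this]
  \<comment> \<open>Passing to the open box does not change the integral, and injectivity is assumed
    only on the open rectangle.\<close>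
  have hi: "((\<lambda>v. \<bar>det (matrix (g' v))\<bar>) has_integral ?I) (box l u)"
    unfolding has_integral_open_interval by (simp add: det J_def l_def u_def)
  have injg: "inj_on g (box l u)"
  proof (rule inj_onI)
    fix v w assume v: "v \<in> box l u" and w: "w \<in> box l u" and eq: "g v = g w"
    have "F (J v) = F (J w)" using eq unfolding g_def by (metis JJ')
    then have "J v = J w"
      by (rule inj_onD[OF inj]) (use v w in \<open>simp_all add: mem_box_2 J_def l_def u_def\<close>)
    then show "v = w" by (metis J'J)
  qed
  have sub: "box l u \<subseteq> cbox l u" by (rule box_subset_cbox)
  have lm: "box l u \<in> sets lebesgue" by simp
  have intg: "(\<lambda>v. \<bar>det (matrix (g' v))\<bar>) integrable_on box l u" using hi by blast
  have derS: "(g has_derivative g' v) (at v within box l u)" if "v \<in> box l u" for v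
    using der that sub by blast
  have "?I = integral (box l u) (\<lambda>v. \<bar>det (matrix (g' v))\<bar>)" using hi by (simp add: integral_unique)
  also have "\<dots> = measure lebesgue (g ` box l u)"
    using measure_differentiable_image_eq[OF lm derS injg intg] by simp
  also have "\<dots> \<le> measure lebesgue (cbox (vector [-M,-M] :: real^2) (vector [M,M]))"
  proof (rule measure_mono_fmeasurable)
    show "g ` box l u \<subseteq> cbox (vector [-M,-M] :: real^2) (vector [M,M])"
    proof safe
      fix v assume "v \<in> box l u"
      then have "norm (F (J v)) \<le> M" using sub bd by (auto simp: J_def mem_box_2 l_def u_def)
      then have "\<bar>Re (F (J v))\<bar> \<le> M" "\<bar>Im (F (J v))\<bar> \<le> M"
        using abs_Re_le_cmod abs_Im_le_cmod order_trans by blast+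
      then show "g v \<in> cbox (vector [-M,-M]) (vector [M,M])"
        by (auto simp: g_def J'_def mem_cbox_2)
    qed
    show "g ` box l u \<in> sets lebesgue"
      using measurable_differentiable_image_eq[OF lm derS injg] intg by (simp add: fmeasurableD)
  qed simp
  also have "\<dots> = 4 * M\<^sup>2"
    using content_cbox_2[of "vector [-M,-M]" "vector [M,M]"] \<open>M \<ge> 0\<close>
    by (simp add: content_Pair power2_eq_square)
  finally show ?thesis by (simp add: case_prod_unfold)
qed

text \<open>The parameter \<open>q\<close> comes from \<open>|F'| \<le> q |F'|^2 + 1 / q\<close>, which replaces Cauchy-Schwarz.\<close>
lemma integral_norm_power_le:
  fixes c d :: real
  assumes U: "open U" and F: "F holomorphic_on U"
    and rect: "\<And>s t. s \<in> {a..b} \<Longrightarrow> t \<in> {c..d} \<Longrightarrow> Complex s t \<in> U"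
    and inj: "inj_on F {w. a < Re w \<and> Re w < b \<and> c < Im w \<and> Im w < d}"
    and bd: "\<And>s t. s \<in> {a..b} \<Longrightarrow> t \<in> {c..d} \<Longrightarrow> norm (F (Complex s t)) \<le> M"
    and M: "M \<ge> 0" and q: "q > 0" and s: "s \<in> {a..b}" and cd: "c \<le> d"
  shows "integral {c..d} (\<lambda>t. norm (F (Complex s t)) ^ m) \<le>
    integral {c..d} (\<lambda>t. norm (F (Complex a t)) ^ m) +
      m * M ^ (m - 1) * (q * (4 * M\<^sup>2) + (b - a) * (d - c) / q)"
proof -
  define A where "A = real m * M ^ (m - 1)"
  define N where "N = (\<lambda>t s. (norm (deriv F (Complex s t)))\<^sup>2)"
  \<comment> \<open>\<open>H\<close> will dominate the modulus of the derivative of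
    \<open>F ^ m\<close> in the direction of \<open>s\<close>. The variable \<open>t\<close> comes
    first because the integral over \<open>s\<close> is the inner one.\<close>
  define H where "H = (\<lambda>(t, s). A * (q * N t s + 1 / q))"
  have A: "A \<ge> 0" using M by (simp add: A_def)
  have ab: "a \<le> b" using s by simp
  have contF: "continuous_on U F" using F by (rule holomorphic_on_imp_continuous_on)
  have contF': "continuous_on U (deriv F)"
    using holomorphic_deriv[OF F U] by (rule holomorphic_on_imp_continuous_on)
  have contN: "continuous_on (cbox (c,a) (d,b)) (\<lambda>(t, s). N t s)"
    unfolding N_def case_prod_unfold
  proof (intro continuous_intros)
    have "continuous_on (cbox (c,a) (d,b)) (\<lambda>p. Complex (snd p) (fst p))"
      unfolding Complex_eq by (intro continuous_intros)
    with contF' show "continuous_on (cbox (c,a) (d,b)) (\<lambda>p. deriv F (Complex (snd p) (fst p)))"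
      by (rule continuous_on_compose2) (use rect in \<open>auto simp: cbox_Pair_eq\<close>)
  qed
  then have contH: "continuous_on (cbox (c,a) (d,b)) H"
    unfolding H_def case_prod_unfold by (intro continuous_intros)
  have contt: "continuous_on {c..d} (\<lambda>t. norm (F (Complex \<sigma> t)) ^ m)" if "\<sigma> \<in> {a..b}" for \<sigma>
  proof (intro continuous_intros)
    have "continuous_on {c..d} (\<lambda>t. Complex \<sigma> t)" unfolding Complex_eq by (intro continuous_intros)
    with contF show "continuous_on {c..d} (\<lambda>t. F (Complex \<sigma> t))"
      by (rule continuous_on_compose2) (use rect that in auto)
  qed
  have pointwise: "norm (F (Complex s t)) ^ m \<le>
      norm (F (Complex a t)) ^ m + integral {a..b} (\<lambda>\<sigma>. H (t, \<sigma>))" if t: "t \<in> {c..d}" for t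
  proof -
    \<comment> \<open>Differentiating \<open>F ^ m\<close> instead of its modulus avoids trouble at
      zeros of \<open>F\<close>; moduli are taken only after integration.\<close>
    define G where "G = (\<lambda>\<sigma>. F (Complex \<sigma> t) ^ m)"
    define G' where "G' = (\<lambda>\<sigma>. of_nat m * F (Complex \<sigma> t) ^ (m - 1) * deriv F (Complex \<sigma> t))"
    have "(G has_vector_derivative G' \<sigma>) (at \<sigma> within {a..s})" if "\<sigma> \<in> {a..s}" for \<sigma>
    proof -
      have "Complex \<sigma> t \<in> U" using rect t s that by auto
      then have "(F has_field_derivative deriv F (Complex \<sigma> t)) (at (Complex \<sigma> t))"
        using holomorphic_derivI[OF F U] by blast
      then have 1: "((\<lambda>w. F w ^ m) has_field_derivative G' \<sigma>) (at (Complex \<sigma> t))"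
        unfolding G'_def by (auto intro!: derivative_eq_intros)
      have "((\<lambda>\<sigma>. Complex \<sigma> t) has_vector_derivative 1) (at \<sigma> within {a..s})"
        unfolding Complex_eq by (auto intro!: derivative_eq_intros)
      from field_vector_diff_chain_within[OF this has_field_derivative_at_within[OF 1]]
      show ?thesis by (simp add: G_def o_def)
    qed
    then have FTC: "(G' has_integral (G s - G a)) {a..s}"
      using s by (intro fundamental_theorem_of_calculus) auto
    have Hint: "(\<lambda>\<sigma>. H (t, \<sigma>)) integrable_on {a..b}"
      using continuous_on_imp_integrable_on_Pair1[OF contH, of t] t by simp
    have Hint': "(\<lambda>\<sigma>. H (t, \<sigma>)) integrable_on {a..s}"
      using integrable_subinterval_real[OF Hint] s by simp
    have H0: "H (t, \<sigma>) \<ge> 0" for \<sigma> using A q by (simp add: H_def N_def)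
    have "norm (G' \<sigma>) \<le> H (t, \<sigma>)" if \<sigma>: "\<sigma> \<in> {a..s}" for \<sigma>
    proof -
      define x where "x = norm (deriv F (Complex \<sigma> t))"
      have "x * q \<le> (q * x)\<^sup>2 + 1"
        using sum_power2_ge_zero[of "q * x - 1/2" 0] by (simp add: power2_eq_square algebra_simps)
      then have x: "x \<le> q * x\<^sup>2 + 1 / q" using q by (simp add: field_simps power2_eq_square)
      have "norm (F (Complex \<sigma> t)) ^ (m - 1) \<le> M ^ (m - 1)"
        using bd \<sigma> s t by (intro power_mono) auto
      then have "norm (G' \<sigma>) \<le> A * x"
        by (simp add: G'_def norm_mult norm_power A_def x_def mult_left_mono mult_right_mono)
      also have "\<dots> \<le> A * (q * x\<^sup>2 + 1 / q)" using x A by (rule mult_left_mono)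
      finally show ?thesis by (simp add: H_def N_def x_def)
    qed
    then have "norm (integral {a..s} G') \<le> integral {a..s} (\<lambda>\<sigma>. H (t, \<sigma>))"
      using FTC Hint' by (intro integral_norm_bound_integral) auto
    also have "\<dots> \<le> integral {a..b} (\<lambda>\<sigma>. H (t, \<sigma>))"
      using s Hint Hint' H0 by (intro integral_subset_le) auto
    finally have "norm (G s - G a) \<le> integral {a..b} (\<lambda>\<sigma>. H (t, \<sigma>))"
      using FTC by (simp add: integral_unique)
    then show ?thesis
      using norm_triangle_ineq2[of "G s" "G a"] by (simp add: G_def norm_power)
  qed
  have int2: "(\<lambda>t. integral {a..b} (\<lambda>\<sigma>. H (t, \<sigma>))) integrable_on {c..d}"
    using integral_integrable_2dim[OF contH] by simp
  have int1: "(\<lambda>t. norm (F (Complex \<sigma> t)) ^ m) integrable_on {c..d}" if "\<sigma> \<in> {a..b}" for \<sigma>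
    using contt[OF that] by (rule integrable_continuous_real)
  have "integral {c..d} (\<lambda>t. norm (F (Complex s t)) ^ m) \<le>
     integral {c..d} (\<lambda>t. norm (F (Complex a t)) ^ m + integral {a..b} (\<lambda>\<sigma>. H (t, \<sigma>)))"
    using s ab by (intro integral_le int1 int2 integrable_add pointwise) auto
  also have "\<dots> = integral {c..d} (\<lambda>t. norm (F (Complex a t)) ^ m) +
      integral {c..d} (\<lambda>t. integral {a..b} (\<lambda>\<sigma>. H (t, \<sigma>)))"
    using ab by (intro integral_add int1 int2) auto
  also have "integral {c..d} (\<lambda>t. integral {a..b} (\<lambda>\<sigma>. H (t, \<sigma>))) = integral (cbox (c,a) (d,b)) H"
    using integral_prod_continuous[OF contH] by simp
  also have "\<dots> = A * (q * integral (cbox (c,a) (d,b)) (\<lambda>(t, s). N t s) + (b - a) * (d - c) / q)"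
  proof -
    have iN: "(\<lambda>(t, s). N t s) integrable_on cbox (c,a) (d,b)"
      using contN by (rule integrable_continuous)
    have "integral (cbox (c,a) (d,b)) H =
      integral (cbox (c,a) (d,b)) (\<lambda>p. A * (q * (case p of (t, s) \<Rightarrow> N t s) + 1 / q))"
      by (simp add: H_def case_prod_unfold)
    also have "\<dots> = A * integral (cbox (c,a) (d,b)) (\<lambda>p. q * (case p of (t, s) \<Rightarrow> N t s) + 1 / q)"
      by (rule integral_mult_right)
    also have "integral (cbox (c,a) (d,b)) (\<lambda>p. q * (case p of (t, s) \<Rightarrow> N t s) + 1 / q) =
      integral (cbox (c,a) (d,b)) (\<lambda>p. q * (case p of (t, s) \<Rightarrow> N t s)) +
      integral (cbox (c,a) (d,b)) (\<lambda>p. 1 / q)"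
      using iN by (intro integral_add integrable_on_mult_right integrable_const)
    also have "integral (cbox (c,a) (d,b)) (\<lambda>p. 1 / q) = (b - a) * (d - c) / q"
      using ab cd by (simp add: content_Pair)
    finally show ?thesis by simp
  qed
  also have "integral (cbox (c,a) (d,b)) (\<lambda>(t, s). N t s) = integral (cbox (a,c) (b,d)) (\<lambda>(s, t). N t s)"
    using integral_swap_2dim[of c a d b N] contN by simp
  also have "\<dots> \<le> 4 * M\<^sup>2"
    unfolding N_def using integral_norm_deriv_square_le[OF U F rect inj bd M] by simp
  finally show ?thesis using A q unfolding A_def
    by (simp add: mult_left_mono)
qed

section \<open>From growth to Hardy spaces\<close>

text \<open>In the coordinate \<open>log z\<close> the strip between consecutive levels
  \<open>sk k\<close> has width of order \<open>(1/2) ^ k\<close>, while \<open>f\<close> is bounded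
  there by a small power of \<open>2 ^ k\<close>. The means of \<open>|f| ^ m\<close> thus increase
  by at most the terms of a convergent geometric series.\<close>

lemma mem_hardy_space_of_nat:
  fixes m :: nat
  assumes f: "f holomorphic_on ball 0 1" and inj: "inj_on f (ball 0 1)" and m: "m \<ge> 1"
    and growth: "\<And>e. e > 0 \<Longrightarrow> \<exists>C. \<forall>z. norm z < 1 \<longrightarrow> norm (f z) \<le> C * (1 - norm z) powr (- e)"
  shows "f \<in> hardy_space (real m)"
proof -
  \<comment> \<open>Makes \<open>M ^ (m + 1)\<close> below of order \<open>2 powr (k / 4)\<close>,
    which loses against \<open>q = 2 powr (- k / 2)\<close>; the product decays like
    \<open>\<rho> ^ k\<close>.\<close>
  define e where "e = 1 / (4 * (real m + 1))"
  have e: "e > 0" "e * (real m + 1) = 1/4" by (auto simp: e_def field_simps)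
  obtain C0 where C0: "\<And>z. norm z < 1 \<Longrightarrow> norm (f z) \<le> C0 * (1 - norm z) powr (- e)"
    using growth[OF e(1)] by blast
  define C where "C = max 1 C0"
  have C1: "C \<ge> 1" by (simp add: C_def)
  have C: "norm (f z) \<le> C * (1 - norm z) powr (- e)" if "norm z < 1" for z
    using C0[OF that] by (rule order_trans) (simp add: C_def mult_right_mono)
  define U where "U = {w. Re w < 0}"
  \<comment> \<open>logarithmic coordinates turn annuli into rectangles\<close>
  define F where "F = (\<lambda>w. f (exp w))"
  have U: "open U" unfolding U_def by (rule open_halfspace_Re_lt)
  have expU: "exp w \<in> ball 0 1" if "w \<in> U" for w using that by (simp add: U_def)
  have F: "F holomorphic_on U"
    unfolding F_def by (rule holomorphic_on_compose_gen[OF _ f, unfolded o_def])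
      (use expU in \<open>auto intro!: holomorphic_intros\<close>)
  \<comment> \<open>The exponential is injective on open strips of height \<open>2 * pi\<close>. The
    edges \<open>Im w = 0\<close> and \<open>Im w = 2 * pi\<close> have the same image, whence the
    open rectangle.\<close>
  have injF: "inj_on F {w. a < Re w \<and> Re w < b \<and> 0 < Im w \<and> Im w < 2 * pi}" if "b \<le> 0" for a b
  proof (rule inj_onI)
    fix w w' assume w: "w \<in> {w. a < Re w \<and> Re w < b \<and> 0 < Im w \<and> Im w < 2 * pi}"
      "w' \<in> {w. a < Re w \<and> Re w < b \<and> 0 < Im w \<and> Im w < 2 * pi}" and eq: "F w = F w'"
    have "exp w = exp w'"
      by (rule inj_onD[OF inj eq[unfolded F_def]]; rule expU) (use w that in \<open>auto simp: U_def\<close>)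
    moreover have "\<bar>Im w - Im w'\<bar> < 2 * pi" using w by (simp add: abs_less_iff)
    ultimately show "w = w'" by (simp add: exp_complex_eqI)
  qed
  have half: "(1/2 :: real) ^ n = 2 powr (- real n)" for n
    by (simp add: powr_minus powr_realpow power_divide inverse_eq_divide)
  have powr_pow: "(2 powr y) ^ n = 2 powr (y * real n)" for y :: real and n
    by (subst powr_realpow[symmetric]) (simp_all add: powr_powr)
  define J where "J = (\<lambda>s. integral {0..2*pi} (\<lambda>t. norm (F (Complex s t)) ^ m))"
  \<comment> \<open>Levels of \<open>ln |z|\<close>, starting at -1; their distance to 0 halves each
    time.\<close>
  define sk where "sk = (\<lambda>k. - ((1/2 :: real) ^ k))"
  have sk_less: "sk k < 0" for k by (simp add: sk_def)
  have sk_Suc: "sk (Suc k) - sk k = (1/2) ^ Suc k" for k by (simp add: sk_def)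
  define B where "B = m * C ^ (m + 1) * (4 + pi) * 2 powr (1/2)"
  have B: "B \<ge> 0" using C1 by (simp add: B_def)
  define \<rho> :: real where "\<rho> = 2 powr (- 1/4)"
  have \<rho>: "0 \<le> \<rho>" "\<rho> < 1" by (auto simp: \<rho>_def intro: powr_less_one)
  have step: "J s \<le> J (sk k) + B * \<rho> ^ k" if s: "s \<in> {sk k..sk (Suc k)}" for s k
  proof -
    define M where "M = C * 2 powr (e * (real k + 2))"
    \<comment> \<open>With this choice \<open>q ^ 2\<close> is twice the strip width, so the area
      term is \<open>4 * q * M ^ 2\<close> and the length term is \<open>pi * q\<close>.\<close>
    define q where "q = 2 powr (- real k / 2)"
    have "1 * 1 \<le> C * 2 powr (e * (real k + 2))"
      using C1 e by (intro mult_mono ge_one_powr_ge_zero) auto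
    then have M: "M \<ge> 1" by (simp add: M_def)
    have bd: "norm (F (Complex \<sigma> t)) \<le> M" if \<sigma>: "\<sigma> \<in> {sk k..sk (Suc k)}" for \<sigma> t
    proof -
      have "(1/2 :: real) ^ k \<le> 1" by (intro power_le_one) auto
      then have "-1 \<le> sk k" by (simp add: sk_def)
      then have \<sigma>1: "-1 \<le> \<sigma>" "\<sigma> < 0" using \<sigma> sk_less[of "Suc k"] by auto
      \<comment> \<open>Bounds the distance to the unit circle from below:
        \<open>1 - exp \<sigma>\<close> is at least \<open>- \<sigma> / 2\<close> on
        \<open>[-1, 0)\<close>, and \<open>- \<sigma>\<close> is at least
        \<open>(1/2) ^ (k + 1)\<close>.\<close>
      have "exp (-\<sigma>) \<ge> 1 - \<sigma>" using exp_ge_add_one_self[of "-\<sigma>"] by simp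
      then have "exp \<sigma> \<le> 1 / (1 - \<sigma>)" using \<sigma>1 by (simp add: exp_minus field_simps)
      then have "1 - exp \<sigma> \<ge> - \<sigma> / (1 - \<sigma>)" using \<sigma>1 by (simp add: field_simps)
      moreover have "- \<sigma> / (1 - \<sigma>) \<ge> - \<sigma> / 2" using \<sigma>1 by (intro divide_left_mono) auto
      moreover have "- \<sigma> / 2 \<ge> (1/2) ^ (k + 2)" using \<sigma> by (simp add: sk_def)
      ultimately have "1 - exp \<sigma> \<ge> (1/2) ^ (k + 2)" by linarith
      then have "(1 - exp \<sigma>) powr (- e) \<le> ((1/2) ^ (k + 2)) powr (- e)"
        using e by (intro powr_mono2') auto
      also have "\<dots> = 2 powr (e * (real k + 2))"
        unfolding half powr_powr by (simp add: algebra_simps)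
      finally have "C * (1 - exp \<sigma>) powr (- e) \<le> M" using C1 by (simp add: M_def)
      moreover have "norm (F (Complex \<sigma> t)) \<le> C * (1 - exp \<sigma>) powr (- e)"
        using C[of "exp (Complex \<sigma> t)"] \<sigma>1 by (simp add: F_def)
      ultimately show ?thesis by linarith
    qed
    have "J s \<le> J (sk k) +
      m * M ^ (m - 1) * (q * (4 * M\<^sup>2) + (sk (Suc k) - sk k) * (2 * pi - 0) / q)"
      unfolding J_def
    proof (rule integral_norm_power_le[OF U F _ injF bd])
      show "Complex s t \<in> U" if "s \<in> {sk k..sk (Suc k)}" for s t
        using that sk_less[of "Suc k"] by (simp add: U_def)
    qed (use M s sk_less[of "Suc k"] in \<open>auto simp: q_def\<close>)
    also have "m * M ^ (m - 1) * (q * (4 * M\<^sup>2) + (sk (Suc k) - sk k) * (2 * pi - 0) / q) \<le> B * \<rho> ^ k"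
    proof -
      have "(1/2 :: real) ^ k = q * q"
        unfolding half q_def powr_add[symmetric] by simp
      then have "(sk (Suc k) - sk k) * (2 * pi - 0) / q = pi * q"
        unfolding sk_Suc by (simp add: q_def)
      also have "\<dots> \<le> pi * (q * M\<^sup>2)" using M by (simp add: q_def)
      finally have "m * M ^ (m - 1) * (q * (4 * M\<^sup>2) + (sk (Suc k) - sk k) * (2 * pi - 0) / q) \<le>
          m * M ^ (m - 1) * (q * (4 * M\<^sup>2) + pi * (q * M\<^sup>2))"
        using M by (intro mult_left_mono) auto
      also have "\<dots> = m * (M ^ (m - 1) * M\<^sup>2) * (4 + pi) * q" by (simp add: algebra_simps)
      \<comment> \<open>\<open>m \<ge> 1\<close> matters here, since subtraction on
        \<open>nat\<close> is truncated.\<close>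
      also have "M ^ (m - 1) * M\<^sup>2 = M ^ (m + 1)"
        using m by (simp flip: power_add)
      also have "M ^ (m + 1) = C ^ (m + 1) * 2 powr (e * (real k + 2) * real (m + 1))"
        unfolding M_def power_mult_distrib powr_pow by simp
      also have "e * (real k + 2) * real (m + 1) = (e * (real m + 1)) * (real k + 2)" by simp
      also have "\<dots> = (real k + 2) / 4" unfolding e(2) by simp
      also have "m * (C ^ (m + 1) * 2 powr ((real k + 2) / 4)) * (4 + pi) * q =
          m * C ^ (m + 1) * (4 + pi) * (2 powr ((real k + 2) / 4) * q)" by simp
      also have "2 powr ((real k + 2) / 4) * q = 2 powr (1/2) * \<rho> ^ k"
        unfolding q_def \<rho>_def powr_pow powr_add[symmetric]
        by (intro arg_cong[where f = "(powr) 2"]) (simp add: field_simps)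
      finally show ?thesis by (simp add: B_def)
    qed
    finally show ?thesis by simp
  qed
  \<comment> \<open>Telescopes the one-strip estimate over the first \<open>k\<close>
    strips.\<close>
  have J_le: "J s \<le> J (-1) + (\<Sum>j<k. B * \<rho> ^ j)" if "s \<in> {-1..sk k}" for s k
    using that
  proof (induction k arbitrary: s)
    case 0
    then show ?case by (simp add: sk_def)
  next
    case (Suc k)
    have "(1/2 :: real) ^ k \<le> 1" by (intro power_le_one) auto
    then have "sk k \<in> {-1..sk k}" by (simp add: sk_def)
    show ?case
    proof (cases "s \<le> sk k")
      case True
      then have "J s \<le> J (-1) + (\<Sum>j<k. B * \<rho> ^ j)" using Suc by simp
      then show ?thesis using B \<rho> by (simp add: add_increasing2 add.assoc[symmetric])
    next
      case False
      then have "J s \<le> J (sk k) + B * \<rho> ^ k" using Suc.prems by (intro step) auto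
      with Suc.IH[OF \<open>sk k \<in> {-1..sk k}\<close>] show ?thesis by simp
    qed
  qed
  have J_bd: "J s \<le> J (-1) + B / (1 - \<rho>)" if s: "-1 \<le> s" "s < 0" for s
  proof -
    obtain k where "(1/2 :: real) ^ k < - s"
      using real_arch_pow_inv[of "- s" "1/2"] s by auto
    then have "J s \<le> J (-1) + (\<Sum>j<k. B * \<rho> ^ j)" using s by (intro J_le) (simp add: sk_def)
    also have "(\<Sum>j<k. B * \<rho> ^ j) = B * (\<Sum>j<k. \<rho> ^ j)" by (simp add: sum_distrib_left)
    also have "(\<Sum>j<k. \<rho> ^ j) \<le> (\<Sum>j. \<rho> ^ j)"
      using \<rho> by (intro sum_le_suminf) auto
    also have "\<dots> = 1 / (1 - \<rho>)" using \<rho> by (intro suminf_geometric) auto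
    finally show ?thesis using B by (simp add: mult_left_mono)
  qed
  \<comment> \<open>The first term covers radii with \<open>ln r \<ge> -1\<close>; on the smaller
    circles the growth bound alone suffices.\<close>
  define K where "K = max (J (-1) + B / (1 - \<rho>)) (2 * pi * (C * (1 - exp (-1)) powr (- e)) ^ m)"
  have "integral {0..2*pi} (\<lambda>\<theta>. norm (f (of_real r * cis \<theta>)) powr real m) \<le> K"
    if r: "r \<in> {0<..<1}" for r
  proof -
    \<comment> \<open>At \<open>y = 0\<close> both sides vanish because \<open>0 powr p = 0\<close>
      and \<open>m \<ge> 1\<close>.\<close>
    have powr_eq: "(y::real) powr real m = y ^ m" if "y \<ge> 0" for y
      using that m by (cases "y = 0") (auto simp: powr_realpow)
    have "(\<lambda>\<theta>. norm (f (of_real r * cis \<theta>)) powr real m) = (\<lambda>t. norm (F (Complex (ln r) t)) ^ m)"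
      using r by (simp add: F_def exp_eq_polar powr_eq)
    then have eq: "integral {0..2*pi} (\<lambda>\<theta>. norm (f (of_real r * cis \<theta>)) powr real m) = J (ln r)"
      by (simp add: J_def)
    show ?thesis
    proof (cases "ln r \<ge> -1")
      case True
      then have "J (ln r) \<le> J (-1) + B / (1 - \<rho>)" using r by (intro J_bd) auto
      then show ?thesis unfolding eq K_def by linarith
    next
      case False
      then have r1: "r \<le> exp (-1)" using r by (metis exp_ln greaterThanLessThan_iff exp_le_cancel_iff linear)
      have bd: "norm (F (Complex (ln r) t)) \<le> C * (1 - exp (-1)) powr (- e)" for t
      proof -
        have "norm (F (Complex (ln r) t)) \<le> C * (1 - r) powr (- e)"
          using C[of "exp (Complex (ln r) t)"] r by (simp add: F_def)
        also have "\<dots> \<le> C * (1 - exp (-1)) powr (- e)"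
          using r1 e C1 by (intro mult_left_mono powr_mono2') auto
        finally show ?thesis .
      qed
      have "norm (J (ln r)) \<le> (C * (1 - exp (-1)) powr (- e)) ^ m * (2 * pi - 0)"
        unfolding J_def
      proof (rule integral_bound)
        show "continuous_on {0..2*pi} (\<lambda>t. norm (F (Complex (ln r) t)) ^ m)"
        proof (intro continuous_intros)
          have "continuous_on U F" using F by (rule holomorphic_on_imp_continuous_on)
          moreover have "continuous_on {0..2*pi} (\<lambda>t. Complex (ln r) t)"
            unfolding Complex_eq by (intro continuous_intros)
          ultimately show "continuous_on {0..2*pi} (\<lambda>t. F (Complex (ln r) t))"
            by (rule continuous_on_compose2) (use r in \<open>auto simp: U_def\<close>)
        qed
        show "norm (norm (F (Complex (ln r) t)) ^ m) \<le> (C * (1 - exp (-1)) powr (- e)) ^ m" for t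
          using power_mono[OF bd] by simp
      qed simp
      then show ?thesis unfolding eq K_def by (simp add: mult.commute)
    qed
  qed
  then have "bdd_above ((\<lambda>r. integral {0..2*pi} (\<lambda>\<theta>. norm (f (of_real r * cis \<theta>)) powr real m)) ` {0<..<1})"
    by (intro bdd_aboveI2)
  then show ?thesis using f by (simp add: hardy_space_def)
qed

section \<open>Growth of holomorphic maps into a comb\<close>

lemma has_vector_derivative_along_ray:
  assumes f: "f holomorphic_on ball 0 1" and z: "norm (of_real \<sigma> * z) < 1"
  shows "((\<lambda>\<sigma>. f (of_real \<sigma> * z)) has_vector_derivative deriv f (of_real \<sigma> * z) * z) (at \<sigma>)"
proof -
  have "(f has_field_derivative deriv f (of_real \<sigma> * z)) (at (of_real \<sigma> * z))"
    using holomorphic_derivI[OF f open_ball] z by simp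
  moreover have "((\<lambda>\<sigma>. of_real \<sigma> * z) has_vector_derivative z) (at \<sigma>)"
    by (auto intro!: derivative_eq_intros)
  ultimately show ?thesis
    using field_vector_diff_chain_at[of "\<lambda>\<sigma>. of_real \<sigma> * z" z \<sigma> f "deriv f (of_real \<sigma> * z)"]
    by (simp add: o_def mult.commute[of z])
qed

text \<open>\<open>\<phi>\<close> is a lower bound for the quasihyperbolic density of the comb as a function of the real part, and
  \<open>\<Phi>\<close> measures horizontal distance with respect to it.\<close>
lemma comb_gauge:
  fixes x :: "nat \<Rightarrow> real"
  assumes x0: "x 0 = 0" and mono: "strict_mono x" and lim: "filterlim x at_top sequentially"
    and le: "\<And>n. x (Suc n) - x n \<le> exp (real (Suc n))"
    and gap: "filterlim (\<lambda>n. x (Suc n) - x n) at_top sequentially"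
    and K: "K > 0"
  obtains \<Phi> \<phi> :: "real \<Rightarrow> real" and C where
    "\<And>t. t > - x 1 \<Longrightarrow> (\<Phi> has_real_derivative \<phi> t) (at t)"
    "\<And>t. \<phi> t \<ge> 0"
    "\<And>t c. (\<And>n. c \<le> 1 + \<bar>t - x n\<bar>) \<Longrightarrow> c * \<phi> t \<le> 1"
    "\<And>t. t > - x 1 \<Longrightarrow> \<bar>t\<bar> \<le> C * exp (\<Phi> t / K)"
    "C \<ge> 0"
proof -
  \<comment> \<open>The distance to the set of abscissas of the teeth is continuous, so
    \<open>\<Phi>\<close> below is differentiable; integrating from the left edge
    \<open>- x 1\<close> keeps \<open>\<Phi>\<close> nonnegative.\<close>
  define \<rho> where "\<rho> = (\<lambda>t. 1 + infdist t (range x))"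
  define \<phi> where "\<phi> = (\<lambda>t. 1 / \<rho> t)"
  define \<Phi> where "\<Phi> = (\<lambda>t. integral {- x 1..t} \<phi>)"
  have \<rho>1: "\<rho> t \<ge> 1" for t by (simp add: \<rho>_def infdist_nonneg)
  have \<phi>0: "\<phi> t > 0" for t using \<rho>1[of t] by (simp add: \<phi>_def)
  have x1: "x 1 > 0" using strict_monoD[OF mono, of 0 1] x0 by simp
  have x_nonneg: "x n \<ge> 0" for n using strict_mono_mono[OF mono] x0 by (metis monoD le0)
  have cont: "continuous_on A \<phi>" for A
    unfolding \<phi>_def \<rho>_def
    by (intro continuous_intros) (metis \<rho>1 \<rho>_def not_one_le_zero)
  have deriv: "(\<Phi> has_real_derivative \<phi> t) (at t)" if "t > - x 1" for t
  proof -
    have "(\<Phi> has_real_derivative \<phi> t) (at t within {- x 1..t + 1})"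
      unfolding \<Phi>_def using that by (intro integral_has_real_derivative cont) auto
    moreover have "at t within {- x 1..t + 1} = at t"
      using that by (intro at_within_interior) auto
    ultimately show ?thesis by simp
  qed
  have gauge: "c * \<phi> t \<le> 1" if c: "\<And>n. c \<le> 1 + \<bar>t - x n\<bar>" for t c
  proof -
    have "c - 1 \<le> infdist t (range x)"
      unfolding infdist_def using c by (auto simp: dist_real_def intro!: cINF_greatest)
        (metis add.commute diff_le_eq)
    then show ?thesis using \<rho>1[of t] by (simp add: \<phi>_def \<rho>_def field_simps)
  qed
  have \<Phi>_mono: "\<Phi> s \<le> \<Phi> t" if "- x 1 \<le> s" "s \<le> t" for s t
    unfolding \<Phi>_def using that \<phi>0
    by (intro integral_subset_le integrable_continuous_real cont) (auto intro: less_imp_le)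
  have \<Phi>_nonneg: "\<Phi> t \<ge> 0" if "t \<ge> - x 1" for t
    using \<Phi>_mono[of "- x 1" t] that by (simp add: \<Phi>_def)
  \<comment> \<open>Between two teeth the distance to the left one alone bounds
    \<open>\<rho> t\<close> by \<open>1 + (t - x n)\<close>, and integrating the reciprocal gives
    the logarithm.\<close>
  have \<Phi>_step: "\<Phi> (x (Suc n)) \<ge> \<Phi> (x n) + ln (1 + (x (Suc n) - x n))" for n
  proof -
    have less: "x n < x (Suc n)" using mono by (simp add: strict_mono_Suc_iff)
    have "\<Phi> (x n) - ln (1 + (x n - x n)) \<le> \<Phi> (x (Suc n)) - ln (1 + (x (Suc n) - x n))"
    proof (rule DERIV_nonneg_imp_nondecreasing[where f = "\<lambda>t. \<Phi> t - ln (1 + (t - x n))"])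
      fix t assume t: "x n \<le> t" "t \<le> x (Suc n)"
      have "t > - x 1" using t x_nonneg[of n] x1 by linarith
      then have "((\<lambda>t. \<Phi> t - ln (1 + (t - x n))) has_real_derivative (\<phi> t - 1 / (1 + (t - x n)))) (at t)"
        using t by (auto intro!: derivative_eq_intros deriv)
      moreover have "\<phi> t \<ge> 1 / (1 + (t - x n))"
      proof -
        have "infdist t (range x) \<le> dist t (x n)" by (rule infdist_le) simp
        then have "\<rho> t \<le> 1 + (t - x n)" using t by (simp add: \<rho>_def dist_real_def)
        then show ?thesis unfolding \<phi>_def using \<rho>1[of t] by (intro divide_left_mono) auto
      qed
      ultimately show "\<exists>y. ((\<lambda>t. \<Phi> t - ln (1 + (t - x n))) has_real_derivative y) (at t) \<and> 0 \<le> y"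
        by fastforce
    qed (use less in simp)
    then show ?thesis by simp
  qed
  \<comment> \<open>From \<open>x n0\<close> on, each strip adds at least \<open>K\<close> to
    \<open>\<Phi>\<close>, because \<open>ln (1 + exp K) \<ge> K\<close>.\<close>
  obtain n0 where n0: "\<And>n. n \<ge> n0 \<Longrightarrow> x (Suc n) - x n \<ge> exp K"
    using gap by (auto simp: filterlim_at_top eventually_sequentially)
  have \<Phi>_lower: "\<Phi> (x (n0 + j)) \<ge> K * real j" for j
  proof (induction j)
    case 0
    show ?case using \<Phi>_nonneg[of "x n0"] x_nonneg[of n0] x1 by simp
  next
    case (Suc j)
    have "1 + (x (Suc (n0 + j)) - x (n0 + j)) \<ge> exp K" using n0[of "n0 + j"] by simp
    then have "ln (1 + (x (Suc (n0 + j)) - x (n0 + j))) \<ge> K"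
      by (subst ln_ge_iff) (use less_le_trans[OF exp_gt_zero] in auto)
    then show ?case using \<Phi>_step[of "n0 + j"] Suc by (simp add: algebra_simps)
  qed
  \<comment> \<open>The gap bounds sum like a geometric series; \<open>exp 1 \<ge> 2\<close> closes
    the induction.\<close>
  have x_le: "x n \<le> exp (real n + 1)" for n
  proof (induction n)
    case (Suc n)
    have "x (Suc n) \<le> x n + exp (real (Suc n))" using le[of n] by simp
    also have "\<dots> \<le> 2 * exp (real n + 1)" using Suc by (simp add: add.commute)
    also have "\<dots> \<le> exp 1 * exp (real n + 1)"
      using exp_ge_add_one_self[of 1] by (intro mult_right_mono) auto
    also have "\<dots> = exp (real (Suc n) + 1)" by (simp add: exp_add[symmetric] add_ac)
    finally show ?case .
  qed (simp add: x0)
  \<comment> \<open>The first summand serves \<open>t \<ge> x n0\<close>, where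
    \<open>exp (k + 1)\<close> occurs with \<open>k = n0 + 1 + j\<close>; the other two serve
    \<open>t\<close> between \<open>- x 1\<close> and \<open>x n0\<close>.\<close>
  define C where "C = exp (real n0 + 2) + x n0 + x 1"
  have C0: "C \<ge> 0" using x_nonneg[of n0] x1 by (simp add: C_def)
  have bound: "\<bar>t\<bar> \<le> C * exp (\<Phi> t / K)" if t: "t > - x 1" for t
  proof (cases "t < x n0")
    case True
    have "\<bar>t\<bar> \<le> C" using True t x_nonneg[of n0] x1 exp_gt_zero[of "real n0 + 2"]
      unfolding C_def by linarith
    also have "\<dots> \<le> C * exp (\<Phi> t / K)"
      using \<Phi>_nonneg[of t] t K C0 by (simp add: mult_le_cancel_left1)
    finally show ?thesis .
  next
    case False
    obtain m where m: "t < x m"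
      using lim by (auto simp: filterlim_at_top_dense eventually_sequentially)
    \<comment> \<open>\<open>x k\<close> is the first tooth strictly to the right of
      \<open>t\<close>. Its predecessor \<open>x (n0 + j)\<close> is not, so \<open>\<Phi> t\<close>
      is at least \<open>K * j\<close>.\<close>
    define k where "k = (LEAST k. t < x k)"
    have k: "t < x k" unfolding k_def using m by (rule LeastI)
    have "k > n0"
      using False k strict_mono_less_eq[OF mono, of k n0] by (meson le_less_trans not_less order_trans less_imp_le)
    then obtain j where j: "k = Suc (n0 + j)" using less_imp_Suc_add by blast
    have xj: "x (n0 + j) \<le> t"
      using not_less_Least[of "n0 + j" "\<lambda>k. t < x k"] j by (simp add: k_def)
    have "K * real j \<le> \<Phi> t"
      using \<Phi>_lower[of j] \<Phi>_mono[OF _ xj] x_nonneg[of "n0 + j"] x1 by simp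
    then have jK: "real j \<le> \<Phi> t / K" using K by (simp add: field_simps)
    have "\<bar>t\<bar> \<le> x k" using k xj x_nonneg[of "n0 + j"] by simp
    also have "\<dots> \<le> exp (real k + 1)" by (rule x_le)
    also have "\<dots> = exp (real n0 + 2) * exp (real j)" by (simp add: j exp_add[symmetric] add_ac)
    also have "\<dots> \<le> C * exp (\<Phi> t / K)"
      using jK x_nonneg[of n0] x1 by (intro mult_mono) (auto simp: C_def)
    finally show ?thesis .
  qed
  show ?thesis
    using that[of \<Phi> \<phi> C, OF deriv less_imp_le[OF \<phi>0] gauge bound C0] .
qed

text \<open>Along a radius, \<open>\<Phi> (Re f)\<close> increases by at most the integral of
  \<open>4 |z| / (1 - \<sigma> |z|)\<close>, which is \<open>- 4 * ln (1 - |z|)\<close>. The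
  exponential bound for the real part in terms of \<open>\<Phi>\<close> turns this logarithm into a
  power.\<close>

lemma Re_growth_comb:
  fixes x :: "nat \<Rightarrow> real"
  assumes x: "x 0 = 0" "strict_mono x" "filterlim x at_top sequentially"
      "\<And>n. x (Suc n) - x n \<le> exp (real (Suc n))"
      "filterlim (\<lambda>n. x (Suc n) - x n) at_top sequentially"
    and f: "f holomorphic_on ball 0 1" and comb: "f ` ball 0 1 \<subseteq> comb_domain x" and e: "e > 0"
  shows "\<exists>C\<ge>0. \<forall>z. norm z < 1 \<longrightarrow> \<bar>Re (f z)\<bar> \<le> C * (1 - norm z) powr (- e)"
proof -
  \<comment> \<open>The exponent obtained at the end is \<open>4 / K\<close>.\<close>
  define K where "K = 4 / e"
  have K: "K > 0" using e by (simp add: K_def)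
  obtain \<Phi> \<phi> :: "real \<Rightarrow> real" and C where
    deriv: "\<And>t. t > - x 1 \<Longrightarrow> (\<Phi> has_real_derivative \<phi> t) (at t)" and
    \<phi>0: "\<And>t. \<phi> t \<ge> 0" and
    gauge: "\<And>t c. (\<And>n. c \<le> 1 + \<bar>t - x n\<bar>) \<Longrightarrow> c * \<phi> t \<le> 1" and
    bound: "\<And>t. t > - x 1 \<Longrightarrow> \<bar>t\<bar> \<le> C * exp (\<Phi> t / K)" and
    C: "C \<ge> 0"
    using comb_gauge[OF x K] by metis
  have Re_gt: "Re (f z) > - x 1" if "norm z < 1" for z
    using comb that by (auto simp: comb_domain_def image_subset_iff)
  have main: "\<Phi> (Re (f z)) \<le> \<Phi> (Re (f 0)) - 4 * ln (1 - norm z)" if z: "norm z < 1" for z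
  proof -
    have lt1: "\<sigma> * norm z < 1" if "0 \<le> \<sigma>" "\<sigma> \<le> 1" for \<sigma>
      using that z by (metis mult_left_le_one_le norm_ge_zero le_less_trans)
    have "\<Phi> (Re (f (of_real 1 * z))) + 4 * ln (1 - 1 * norm z) \<le>
          \<Phi> (Re (f (of_real 0 * z))) + 4 * ln (1 - 0 * norm z)"
    proof (rule DERIV_nonpos_imp_nonincreasing[where
          f = "\<lambda>\<sigma>. \<Phi> (Re (f (of_real \<sigma> * z))) + 4 * ln (1 - \<sigma> * norm z)"])
      fix \<sigma> :: real assume \<sigma>: "0 \<le> \<sigma>" "\<sigma> \<le> 1"
      define w where "w = of_real \<sigma> * z"
      define D where "D = deriv f w * z"
      have w: "norm w = \<sigma> * norm z" using \<sigma> by (simp add: w_def norm_mult)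
      have w1: "norm w < 1" using lt1[OF \<sigma>] w by simp
      have "((\<lambda>\<sigma>. f (of_real \<sigma> * z)) has_vector_derivative D) (at \<sigma>)"
        using has_vector_derivative_along_ray[OF f] w1 by (simp add: w_def D_def)
      then have "((\<lambda>\<sigma>. Re (f (of_real \<sigma> * z))) has_real_derivative Re D) (at \<sigma>)"
        unfolding has_real_derivative_iff_has_vector_derivative
        by (rule bounded_linear.has_vector_derivative[OF bounded_linear_Re])
      from DERIV_chain2[OF _ this, of \<Phi> "\<phi> (Re (f w))"]
      have 1: "((\<lambda>\<sigma>. \<Phi> (Re (f (of_real \<sigma> * z)))) has_real_derivative \<phi> (Re (f w)) * Re D) (at \<sigma>)"
        using deriv[OF Re_gt[OF w1]] by (simp add: w_def)
      have "((\<lambda>\<sigma>. \<Phi> (Re (f (of_real \<sigma> * z))) + 4 * ln (1 - \<sigma> * norm z)) has_real_derivative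
          (\<phi> (Re (f w)) * Re D - 4 * norm z / (1 - norm w))) (at \<sigma>)"
        using lt1[OF \<sigma>] by (auto intro!: derivative_eq_intros 1 simp: w)
      moreover have "\<phi> (Re (f w)) * Re D \<le> 4 * norm z / (1 - norm w)"
      proof -
        \<comment> \<open>\<open>gauge\<close> is applied to the left side of the comb estimate
          divided by 4, since that estimate holds for every tooth simultaneously.\<close>
        have "norm (deriv f w) * (1 - norm w) / 4 * \<phi> (Re (f w)) \<le> 1"
          using norm_deriv_le_comb[OF f comb w1] by (intro gauge) (simp add: field_simps)
        then have "norm (deriv f w) * \<phi> (Re (f w)) \<le> 4 / (1 - norm w)"
          using w1 by (simp add: field_simps)
        then have "norm z * (norm (deriv f w) * \<phi> (Re (f w))) \<le> norm z * (4 / (1 - norm w))"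
          by (rule mult_left_mono) simp
        moreover have "\<phi> (Re (f w)) * Re D \<le> \<phi> (Re (f w)) * norm D"
          using complex_Re_le_cmod \<phi>0 by (rule mult_left_mono)
        ultimately show ?thesis by (simp add: D_def norm_mult mult_ac)
      qed
      ultimately show "\<exists>y. ((\<lambda>\<sigma>. \<Phi> (Re (f (of_real \<sigma> * z))) + 4 * ln (1 - \<sigma> * norm z))
          has_real_derivative y) (at \<sigma>) \<and> y \<le> 0" by fastforce
    qed simp
    then show ?thesis by simp
  qed
  show ?thesis
  proof (intro exI[of _ "C * exp (\<Phi> (Re (f 0)) / K)"] conjI allI impI)
    show "0 \<le> C * exp (\<Phi> (Re (f 0)) / K)" using C by simp
    fix z :: complex assume z: "norm z < 1"
    have "\<bar>Re (f z)\<bar> \<le> C * exp (\<Phi> (Re (f z)) / K)" by (rule bound[OF Re_gt[OF z]])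
    also have "\<dots> \<le> C * exp ((\<Phi> (Re (f 0)) - 4 * ln (1 - norm z)) / K)"
      using main[OF z] C K by (intro mult_left_mono) (auto simp: divide_right_mono)
    also have "(\<Phi> (Re (f 0)) - 4 * ln (1 - norm z)) / K = \<Phi> (Re (f 0)) / K + (- e) * ln (1 - norm z)"
      using e by (simp add: K_def field_simps)
    also have "exp \<dots> = exp (\<Phi> (Re (f 0)) / K) * (1 - norm z) powr (- e)"
      unfolding exp_add powr_def using z by auto
    finally show "\<bar>Re (f z)\<bar> \<le> C * exp (\<Phi> (Re (f 0)) / K) * (1 - norm z) powr (- e)" by simp
  qed
qed

text \<open>The imaginary part is reached through the derivative: the tooth at
  \<open>x 0 = 0\<close> bounds \<open>(1 - |z|) |f'|\<close> in terms of the real part alone, and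
  integrating the resulting bound of order \<open>- e - 1\<close> along the radius yields order
  \<open>- e\<close> again.\<close>

lemma norm_growth_comb:
  fixes x :: "nat \<Rightarrow> real"
  assumes x: "x 0 = 0" "strict_mono x" "filterlim x at_top sequentially"
      "\<And>n. x (Suc n) - x n \<le> exp (real (Suc n))"
      "filterlim (\<lambda>n. x (Suc n) - x n) at_top sequentially"
    and f: "f holomorphic_on ball 0 1" and comb: "f ` ball 0 1 \<subseteq> comb_domain x" and e: "e > 0"
  shows "\<exists>C. \<forall>z. norm z < 1 \<longrightarrow> norm (f z) \<le> C * (1 - norm z) powr (- e)"
proof -
  obtain C where C: "C \<ge> 0" "\<And>z. norm z < 1 \<Longrightarrow> \<bar>Re (f z)\<bar> \<le> C * (1 - norm z) powr (- e)"
    using Re_growth_comb[OF x f comb e] by metis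
  define A where "A = 4 * (1 + C)"
  have ge1: "(1 - norm z) powr (- e) \<ge> 1" if "norm z < 1" for z :: complex
    using that e powr_mono2'[of "- e" "1 - norm z" 1] by simp
  have deriv_le: "norm (deriv f z) \<le> A * (1 - norm z) powr (- e - 1)" if z: "norm z < 1" for z
  proof -
    have "norm (deriv f z) * (1 - norm z) \<le> 4 * (1 + \<bar>Re (f z)\<bar>)"
      using norm_deriv_le_comb[OF f comb z, of 0] x(1) by simp
    also have "\<dots> \<le> A * (1 - norm z) powr (- e)"
      using C(2)[OF z] ge1[OF z] by (simp add: A_def algebra_simps)
    finally show ?thesis using z by (simp add: powr_diff field_simps)
  qed
  have main: "norm (f z - f 0) \<le> A / e * (1 - norm z) powr (- e) - A / e" if z: "norm z < 1" for z
  proof -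
    have lt1: "\<sigma> * norm z < 1" if "0 \<le> \<sigma>" "\<sigma> \<le> 1" for \<sigma>
      using that z by (metis mult_left_le_one_le norm_ge_zero le_less_trans)
    \<comment> \<open>A primitive of \<open>\<psi>'\<close>, the bound for the derivative along the
      radius.\<close>
    define \<psi> where "\<psi> = (\<lambda>\<sigma>. A / e * (1 - \<sigma> * norm z) powr (- e))"
    define \<psi>' where "\<psi>' = (\<lambda>\<sigma>. norm z * (A * (1 - \<sigma> * norm z) powr (- e - 1)))"
    define g where "g = (\<lambda>\<sigma>. f (of_real \<sigma> * z))"
    define g' where "g' = (\<lambda>\<sigma>. deriv f (of_real \<sigma> * z) * z)"
    have dg: "(g has_vector_derivative g' \<sigma>) (at \<sigma>)" if "0 \<le> \<sigma>" "\<sigma> \<le> 1" for \<sigma>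
    proof -
      have "norm (of_real \<sigma> * z) < 1" using lt1[OF that] that by (simp add: norm_mult)
      then show ?thesis
        using has_vector_derivative_along_ray[OF f] by (simp add: g_def g'_def)
    qed
    have d\<psi>: "(\<psi> has_vector_derivative \<psi>' \<sigma>) (at \<sigma>)" if "0 \<le> \<sigma>" "\<sigma> \<le> 1" for \<sigma>
      unfolding \<psi>_def \<psi>'_def has_real_derivative_iff_has_vector_derivative[symmetric]
      using lt1[OF that] e by (auto intro!: derivative_eq_intros simp: powr_diff field_simps)
    have "norm (g 1 - g 0) \<le> \<psi> 1 - \<psi> 0"
    proof (rule differentiable_bound_general)
      show "continuous_on {0..1} g"
        using dg has_vector_derivative_continuous by (intro continuous_at_imp_continuous_on) fastforce
      show "continuous_on {0..1} \<psi>"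
        using d\<psi> has_vector_derivative_continuous by (intro continuous_at_imp_continuous_on) fastforce
      show "norm (g' \<sigma>) \<le> \<psi>' \<sigma>" if "0 < \<sigma>" "\<sigma> < 1" for \<sigma>
        using deriv_le[of "of_real \<sigma> * z"] lt1[of \<sigma>] that
        by (simp add: g'_def \<psi>'_def norm_mult mult.commute mult_left_mono)
    qed (use dg d\<psi> in auto)
    then show ?thesis by (simp add: g_def \<psi>_def)
  qed
  have A: "A \<ge> 0" using C(1) by (simp add: A_def)
  show ?thesis
  proof (intro exI[of _ "norm (f 0) + A / e"] allI impI)
    fix z :: complex assume z: "norm z < 1"
    have "norm (f z) \<le> norm (f 0) + norm (f z - f 0)" by (metis norm_triangle_sub)
    also have "\<dots> \<le> norm (f 0) * (1 - norm z) powr (- e) + A / e * (1 - norm z) powr (- e)"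
      using main[OF z] ge1[OF z] A e
      by (intro add_mono) (auto simp: mult_le_cancel_left1 intro: order_trans)
    finally show "norm (f z) \<le> (norm (f 0) + A / e) * (1 - norm z) powr (- e)"
      by (simp add: algebra_simps)
  qed
qed

section \<open>The Riemann map of a comb\<close>

lemma mem_comb_domain: "z \<in> comb_domain x \<longleftrightarrow> - x 1 < Re z \<and> (Re z \<in> range x \<longrightarrow> \<bar>Im z\<bar> < 1)"
proof -
  have "z = Complex (x n) y \<longleftrightarrow> Re z = x n \<and> Im z = y" for n y by (auto simp: complex_eq_iff)
  then show ?thesis unfolding comb_domain_def by (auto simp: not_le)
qed

text \<open>The gaps make the abscissas uniformly discrete, hence a closed set, and so the union of
  all teeth is closed.\<close>

lemma open_comb_domain:
  assumes gap: "\<And>n. x n + 1 \<le> x (Suc n)"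
  shows "open (comb_domain x)"
proof -
  have far: "x n + real k \<le> x (n + k)" for n k
  proof (induction k)
    case (Suc k)
    then show ?case using gap[of "n + k"] by simp
  qed simp
  have "x m = x n" if "dist (x m) (x n) < 1" for m n
  proof (cases m n rule: linorder_cases)
    case less
    then show ?thesis using far[of m "n - m"] that by (simp add: dist_real_def)
  next
    case greater
    then show ?thesis using far[of n "m - n"] that by (simp add: dist_real_def)
  qed simp
  then have "closed (range x)" by (intro discrete_imp_closed[of 1]) auto
  then have "closed {z. Re z \<in> range x}"
    using continuous_closed_vimage[of "range x" Re] by (simp add: vimage_def)
  moreover have "closed {z. 1 \<le> \<bar>Im z\<bar>}"
    by (intro closed_Collect_le continuous_intros)
  ultimately have "closed ({z. Re z \<in> range x} \<inter> {z. 1 \<le> \<bar>Im z\<bar>})" by (rule closed_Int)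
  then have "open ({z. Re z > - x 1} - ({z. Re z \<in> range x} \<inter> {z. 1 \<le> \<bar>Im z\<bar>}))"
    by (intro open_Diff open_halfspace_Re_gt)
  moreover have "comb_domain x = {z. Re z > - x 1} - ({z. Re z \<in> range x} \<inter> {z. 1 \<le> \<bar>Im z\<bar>})"
    by (auto simp: mem_comb_domain)
  ultimately show ?thesis by simp
qed

text \<open>The domain contracts to 0 in two moves: vertically onto the real axis, which shrinks
  \<open>|Im z|\<close> at fixed real part, and then along the axis, which passes between the tips
  of the teeth.\<close>

lemma simply_connected_comb_domain:
  assumes "x 1 > 0"
  shows "simply_connected (comb_domain x)"
proof -
  let ?D = "comb_domain x" and ?p = "\<lambda>z. complex_of_real (Re z)"
  have "homotopic_with_canon (\<lambda>_. True) ?D ?D id ?p"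
  proof (rule homotopic_with_linear)
    fix z assume z: "z \<in> ?D"
    show "closed_segment (id z) (?p z) \<subseteq> ?D"
    proof
      fix w assume "w \<in> closed_segment (id z) (?p z)"
      then obtain u where u: "0 \<le> u" "u \<le> 1" "w = (1 - u) *\<^sub>R z + u *\<^sub>R ?p z"
        by (auto simp: in_segment)
      have "Re w = Re z" unfolding u(3) by (simp add: algebra_simps)
      moreover have "\<bar>Im w\<bar> \<le> \<bar>Im z\<bar>" using u by (simp add: abs_mult mult_left_le_one_le)
      ultimately show "w \<in> ?D" using z by (auto simp: mem_comb_domain)
    qed
  qed (auto intro!: continuous_intros)
  moreover have "homotopic_with_canon (\<lambda>_. True) ?D ?D ?p (\<lambda>_. 0)"
  proof (rule homotopic_with_linear)
    fix z assume z: "z \<in> ?D"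
    show "closed_segment (?p z) 0 \<subseteq> ?D"
    proof
      fix w assume "w \<in> closed_segment (?p z) 0"
      then obtain u where u: "0 \<le> u" "u \<le> 1" "w = (1 - u) *\<^sub>R ?p z + u *\<^sub>R 0"
        by (auto simp: in_segment)
      have "Re w = (1 - u) * Re z" using u(3) by simp
      moreover have "(1 - u) * Re z > - x 1"
      proof (cases "Re z \<ge> 0")
        case True
        then have "(1 - u) * Re z \<ge> 0" using u by simp
        then show ?thesis using assms by simp
      next
        case False
        then have "(1 - u) * Re z \<ge> Re z" using u by (simp add: algebra_simps mult_nonneg_nonpos)
        then show ?thesis using z by (simp add: mem_comb_domain)
      qed
      ultimately show "w \<in> ?D" using u(3) by (simp add: mem_comb_domain)
    qed
  qed (auto intro!: continuous_intros)
  ultimately have "homotopic_with_canon (\<lambda>_. True) ?D ?D id (\<lambda>_. 0)"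
    by (rule homotopic_with_trans)
  then have "contractible ?D" unfolding contractible_def by blast
  then show ?thesis by (rule contractible_imp_simply_connected)
qed

lemma ex_riemann_mapping:
  assumes "open S" "simply_connected S" "S \<noteq> {}" "S \<noteq> UNIV"
  shows "\<exists>f. riemann_mapping f S"
proof -
  obtain f g where "g holomorphic_on ball 0 1"
    and 1: "\<forall>z\<in>S. f z \<in> ball 0 1 \<and> g (f z) = z" and 2: "\<forall>z\<in>ball 0 1. g z \<in> S \<and> f (g z) = z"
    using assms Riemann_mapping_theorem[of S] by metis
  moreover have "bij_betw g (ball 0 1) S"
    by (rule bij_betw_byWitness[where f' = f]) (use 1 2 in blast)+
  ultimately show ?thesis unfolding riemann_mapping_def by blast
qed

section \<open>Hardy number of the comb\<close>

theorem corollary1p1: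
  fixes x \<alpha> :: "nat \<Rightarrow> real"
  assumes "x 0 = 0"
    and "\<And>n. n \<ge> 1 \<Longrightarrow> x n > 0"
    and "strict_mono_on {1..} x"
    and "filterlim x at_top sequentially"
    and "(INF n\<in>{1..}. x n - x (n - 1)) > 1"
    and "\<And>n. n \<ge> 1 \<Longrightarrow> \<alpha> n = x n - x (n - 1)"
    and "\<And>n. n \<ge> 1 \<Longrightarrow> \<alpha> n \<le> exp (real n)"
    and "filterlim \<alpha> at_top sequentially"
  shows "hardy_number (comb_domain x) = \<infinity>"
proof -
  \<comment> \<open>Monotonicity is given from index 1 on; the step from \<open>x 0\<close> comes
    from positivity.\<close>
  have step: "x n < x (Suc n)" for n
  proof (cases "n = 0")
    case True
    then show ?thesis using assms(1) assms(2)[of 1] by simp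
  next
    case False
    then show ?thesis using strict_mono_onD[OF assms(3), of n "Suc n"] by simp
  qed
  then have mono: "strict_mono x" by (simp add: strict_mono_Suc_iff)
  have gap: "x n + 1 \<le> x (Suc n)" for n
  proof -
    \<comment> \<open>A real infimum is known to be a lower bound only for sets that are bounded
      below.\<close>
    have "bdd_below ((\<lambda>n. x n - x (n - 1)) ` {1..})"
    proof (intro bdd_belowI2)
      show "0 \<le> x n - x (n - 1)" if "n \<in> {1..}" for n
        using step[of "n - 1"] that by simp
    qed
    then have "(INF n\<in>{1..}. x n - x (n - 1)) \<le> x (Suc n) - x (Suc n - 1)"
      by (rule cINF_lower) simp
    then show ?thesis using assms(5) by simp
  qed
  have le: "x (Suc n) - x n \<le> exp (real (Suc n))" for n
    using assms(6)[of "Suc n"] assms(7)[of "Suc n"] by simp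
  have "(\<lambda>n. x (Suc n) - x n) = (\<lambda>n. \<alpha> (Suc n))" using assms(6) by simp
  then have lim: "filterlim (\<lambda>n. x (Suc n) - x n) at_top sequentially"
    using filterlim_compose[OF assms(8) filterlim_Suc] by simp
  have x1: "x 1 > 0" using assms(2) by simp
  \<comment> \<open>The very choice made in \<open>hardy_number\<close>; it is a Riemann mapping
    once one exists.\<close>
  define f where "f = (SOME f. riemann_mapping f (comb_domain x))"
  have "comb_domain x \<noteq> {}"
    using x1 by (metis mem_comb_domain zero_complex.simps abs_zero zero_less_one neg_less_0_iff_less empty_iff)
  moreover have "comb_domain x \<noteq> UNIV"
    by (metis mem_comb_domain UNIV_I Re_complex_of_real less_irrefl)
  ultimately have "\<exists>f. riemann_mapping f (comb_domain x)"
    by (intro ex_riemann_mapping open_comb_domain simply_connected_comb_domain gap x1)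
  then have "riemann_mapping f (comb_domain x)" unfolding f_def by (rule someI_ex)
  then have f: "f holomorphic_on ball 0 1" "inj_on f (ball 0 1)" "f ` ball 0 1 \<subseteq> comb_domain x"
    by (auto simp: riemann_mapping_def bij_betw_def)
  have hardy: "f \<in> hardy_space (real m)" if "m \<ge> 1" for m
    using f(1,2) that norm_growth_comb[OF assms(1) mono assms(4) le lim f(1,3)]
    by (rule mem_hardy_space_of_nat)
  \<comment> \<open>Natural exponents are cofinal in the reals, so they already make the supremum
    infinite.\<close>
  have "ereal B \<le> hardy_number (comb_domain x)" for B
  proof -
    obtain m where m: "B \<le> real m" using real_arch_simple by blast
    have "ereal B \<le> ereal (real (Suc m))" using m by simp
    also have "\<dots> \<le> Sup (ereal ` {p. p > 0 \<and> f \<in> hardy_space p})"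
      using hardy[of "Suc m"] by (intro Sup_upper imageI) simp
    finally show ?thesis by (simp add: hardy_number_def f_def Let_def)
  qed
  then show ?thesis by (rule ereal_top)
qed

end
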